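(* Let $d\ge 2$ and let $N\ge5$ be a prime number. Let $\mathcal{P}=(p_j)_{j=1}^N$ be a sampling scheme in $[0,1)^d$ such that for some $i\in\{1,\dots,d\}$ there exists a constant $0<\epsilon\le\frac12$ with $$\mathbf{P}\big(\operatorname{dist}(p_1^{(i)},p_2^{(i)})\le\epsilon\big)=0.$$ Then $\mathcal{P}$ is not pairwise negatively dependent.
   Context: The coordinates of a point $p_j$ are written $p_j=(p_j^{(1)},\dots,p_j^{(d)})$. The function $\operatorname{dist}:[0,1)^2\to[0,1)$ is the distance on the one-dimensional torus, $\operatorname{dist}(x,y)=\min\big(\max(x,y)-\min(x,y),\ 1-\max(x,y)+\min(x,y)\big)$. A randomized point set $(p_j)_{j=1}^N$ is a sampling scheme if every $p_j$ is uniformly distributed in $[0,1)^d$ and the vector $(p_1,\dots,p_N)$ is exchangeable (its law is invariant under all permutations of the indices). Let $\mathcal{C}_1^d=\{[x,1)\,:\,x\in[0,1)^d\}$, where $[x,1)=\prod_{i=1}^d[x^{(i)},1)$. A sampling scheme is pairwise negatively dependent if $\mathbf{P}(p_1\in Q,p_2\in R)\le\mathbf{P}(p_1\in Q)\mathbf{P}(p_2\in R)$ for all $Q,R\in\mathcal{C}_1^d$. *)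

theory Defs
  imports "HOL-Probability.Probability" "HOL-Combinatorics.Permutations"
begin

(* The dimension d is CARD('d); points of R^d have type real^'d. *)

definition half_open_box :: "real^'d \<Rightarrow> real^'d \<Rightarrow> (real^'d) set" where
  "half_open_box x y = {z. \<forall>i. x $ i \<le> z $ i \<and> z $ i < y $ i}"

(* 0 and 1 are the constant vectors, so this is [0,1)^d. *)
definition unit_cube :: "(real^'d) set" where
  "unit_cube = half_open_box 0 1"

definition upper_corner_boxes :: "(real^'d) set set" where
  "upper_corner_boxes = {half_open_box x 1 | x. x \<in> unit_cube}"

definition torus_dist :: "real \<Rightarrow> real \<Rightarrow> real" where
  "torus_dist x y = min (max x y - min x y) (1 - max x y + min x y)"

(* Equality of the joint laws of (p_1,...,p_N) and (p_s(1),...,p_s(N)) as measures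
   on the N-fold product space. *)
definition exchangeable :: "'a measure \<Rightarrow> nat \<Rightarrow> (nat \<Rightarrow> 'a \<Rightarrow> real^'d) \<Rightarrow> bool" where
  "exchangeable M N p \<longleftrightarrow>
     (\<forall>s. s permutes {1..N} \<longrightarrow>
        distr M (\<Pi>\<^sub>M j\<in>{1..N}. borel) (\<lambda>\<omega>. \<lambda>j\<in>{1..N}. p (s j) \<omega>) =
        distr M (\<Pi>\<^sub>M j\<in>{1..N}. borel) (\<lambda>\<omega>. \<lambda>j\<in>{1..N}. p j \<omega>))"

(* The points are p 1, ..., p N; values of p at other indices are irrelevant. *)
definition sampling_scheme ::
    "'a measure \<Rightarrow> nat \<Rightarrow> (nat \<Rightarrow> 'a \<Rightarrow> real^'d) \<Rightarrow> bool" where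
  "sampling_scheme M N p \<longleftrightarrow>
     (\<forall>j\<in>{1..N}. p j \<in> borel_measurable M \<and>
        (\<forall>\<omega>\<in>space M. p j \<omega> \<in> unit_cube) \<and>
        distr M borel (p j) = uniform_measure lborel unit_cube) \<and>
     exchangeable M N p"

definition pairwise_negatively_dependent ::
    "'a measure \<Rightarrow> (nat \<Rightarrow> 'a \<Rightarrow> real^'d) \<Rightarrow> bool" where
  "pairwise_negatively_dependent M p \<longleftrightarrow>
     (\<forall>Q\<in>upper_corner_boxes. \<forall>R\<in>upper_corner_boxes.
        measure M {\<omega>\<in>space M. p 1 \<omega> \<in> Q \<and> p 2 \<omega> \<in> R} \<le>
        measure M {\<omega>\<in>space M. p 1 \<omega> \<in> Q} * measure M {\<omega>\<in>space M. p 2 \<omega> \<in> R})"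

end

theory Submission imports Defs begin

text \<open>
  Negative dependence prevents mass from concentrating in the quadrants
  \<open>p 1 \<in> Q, p 2 \<in> R\<close>; since the marginals are fixed, it therefore forces mass into the
  complementary quadrants \<open>p 1 \<notin> Q, p 2 \<in> R\<close>. For suitable \<open>Q\<close> and \<open>R\<close> such a quadrant
  contains only pairs that are close on the torus, and these have no mass by assumption. Put \<open>\<delta> = \<epsilon> / 2\<close>, let \<open>Q\<close> consist of the points
  whose \<open>i\<close>-th coordinate is at least \<open>\<delta>\<close>, and \<open>R\<close> of those whose \<open>i\<close>-th coordinate is at
  least \<open>1 - \<delta>\<close>. If \<open>p 1 \<notin> Q\<close> and \<open>p 2 \<in> R\<close>, then the two \<open>i\<close>-th coordinates lie on
  opposite ends of the unit interval and so within torus distance \<open>2 * \<delta> = \<epsilon>\<close>; hence this event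
  is null and \<open>P(p 1 \<in> Q, p 2 \<in> R) = P(p 2 \<in> R)\<close>. Negative dependence bounds the left side by
  \<open>P(p 1 \<in> Q) * P(p 2 \<in> R)\<close>, which is strictly smaller than \<open>P(p 2 \<in> R)\<close>, because uniform
  marginals give \<open>R\<close> and the complement of \<open>Q\<close> positive probability.
\<close>

lemma half_open_box_borel [measurable]:
  fixes x y :: "real^'d"
  shows "half_open_box x y \<in> sets borel"
  unfolding half_open_box_def by measurable

definition upper_slab :: "'d \<Rightarrow> real \<Rightarrow> (real^'d) set" where
  "upper_slab i t = half_open_box (\<chi> k. if k = i then t else 0) 1"

lemma upper_slab_in_upper_corner_boxes:
  assumes "0 \<le> t" "t < 1"
  shows "upper_slab i t \<in> upper_corner_boxes"
proof -
  have "(\<chi> k. if k = i then t else 0) \<in> unit_cube"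
    using assms by (simp add: unit_cube_def half_open_box_def)
  then show ?thesis
    unfolding upper_corner_boxes_def upper_slab_def by blast
qed

lemma mem_upper_slab_iff:
  assumes "z \<in> unit_cube"
  shows "z \<in> upper_slab i t \<longleftrightarrow> t \<le> z $ i"
  using assms by (auto simp: upper_slab_def unit_cube_def half_open_box_def)

lemma torus_dist_le_opposite_ends:
  assumes "0 \<le> a" "a < \<delta>" "1 - \<delta> \<le> b" "b < 1" "\<delta> \<le> 1/2"
  shows "torus_dist a b \<le> 2 * \<delta>"
  using assms unfolding torus_dist_def by (auto simp: min_def max_def)

text \<open>
  Only positivity of probabilities matters for the argument, so bounding below by an open box
  replaces any computation of marginal probabilities.
\<close>

lemma uniform_point_in_set_pos:
  fixes X :: "'a \<Rightarrow> real^'d" and A :: "(real^'d) set"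
  assumes "prob_space M"
    and X: "X \<in> borel_measurable M"
    and unif: "distr M borel X = uniform_measure lborel unit_cube"
    and A: "A \<in> sets borel"
    and sub: "box a b \<subseteq> A \<inter> unit_cube"
    and ne: "box a b \<noteq> {}"
  shows "0 < measure M {\<omega>\<in>space M. X \<omega> \<in> A}"
proof -
  interpret prob_space M by fact
  have cube: "unit_cube \<in> sets (borel :: (real^'d) measure)"
    unfolding unit_cube_def by simp
  have "(unit_cube :: (real^'d) set) \<subseteq> cbox 0 1"
    by (auto simp: unit_cube_def half_open_box_def mem_box_cart less_imp_le)
  then have "emeasure lborel (unit_cube :: (real^'d) set) \<le> emeasure lborel (cbox 0 1 :: (real^'d) set)"
    by (intro emeasure_mono) auto
  also have "\<dots> < \<infinity>" by (rule emeasure_lborel_cbox_finite)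
  finally have fin: "emeasure lborel (unit_cube :: (real^'d) set) \<noteq> top" by simp
  have "emeasure lborel (box a b) \<noteq> 0"
    using open_not_negligible[OF open_box ne]
    by (simp add: negligible_iff_null_sets null_sets_completion_iff null_sets_def)
  moreover have "emeasure lborel (box a b) \<le> emeasure lborel (unit_cube \<inter> A)"
    using sub A cube by (intro emeasure_mono) auto
  ultimately have pos: "emeasure lborel (unit_cube \<inter> A) > 0"
    by (metis not_gr_zero le_zero_eq)
  have "emeasure M {\<omega>\<in>space M. X \<omega> \<in> A} = emeasure (distr M borel X) A"
    using X A by (simp add: emeasure_distr vimage_def Int_def conj_commute)
  also have "\<dots> = emeasure lborel (unit_cube \<inter> A) / emeasure lborel (unit_cube :: (real^'d) set)"
    using A cube by (simp add: unif)
  also have "\<dots> > 0"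
    using pos fin by (simp add: ennreal_zero_less_divide top.not_eq_extremum)
  finally show ?thesis
    by (simp add: emeasure_eq_measure)
qed

theorem proposition3p6:
  fixes M :: "'a measure" and N :: nat and p :: "nat \<Rightarrow> 'a \<Rightarrow> real^'d"
  assumes "prob_space M"
    and "CARD('d) \<ge> 2"
    and "prime N" and "N \<ge> 5"
    and "sampling_scheme M N p"
    and "\<exists>i::'d. \<exists>\<epsilon>::real. 0 < \<epsilon> \<and> \<epsilon> \<le> 1/2 \<and>
           measure M {\<omega>\<in>space M. torus_dist (p 1 \<omega> $ i) (p 2 \<omega> $ i) \<le> \<epsilon>} = 0"
  shows "\<not> pairwise_negatively_dependent M p"
proof
  assume pnd: "pairwise_negatively_dependent M p"
  interpret prob_space M by fact
  from assms(6) obtain i :: 'd and \<epsilon> :: real where \<epsilon>: "0 < \<epsilon>" "\<epsilon> \<le> 1/2"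
    and null: "prob {\<omega>\<in>space M. torus_dist (p 1 \<omega> $ i) (p 2 \<omega> $ i) \<le> \<epsilon>} = 0"
    by blast
  have idx: "1 \<in> {1..N}" "2 \<in> {1..N}" using \<open>N \<ge> 5\<close> by auto
  have point: "p j \<in> borel_measurable M" "\<And>\<omega>. \<omega> \<in> space M \<Longrightarrow> p j \<omega> \<in> unit_cube"
    "distr M borel (p j) = uniform_measure lborel unit_cube" if "j \<in> {1..N}" for j
    using assms(5) that unfolding sampling_scheme_def by blast+
  have [measurable]: "p 1 \<in> borel_measurable M" "p 2 \<in> borel_measurable M"
    using point(1) idx by auto
  have [measurable]: "(\<lambda>\<omega>. p 1 \<omega> $ i) \<in> borel_measurable M" "(\<lambda>\<omega>. p 2 \<omega> $ i) \<in> borel_measurable M"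
    by (rule measurable_compose[OF _ borel_measurable_nth]; measurable)+
  define \<delta> where "\<delta> = \<epsilon> / 2"
  have \<delta>: "0 < \<delta>" "\<delta> \<le> 1/4" "2 * \<delta> = \<epsilon>" using \<epsilon> by (auto simp: \<delta>_def)
  define Q where "Q = upper_slab i \<delta>"
  define R where "R = upper_slab i (1 - \<delta>)"
  have [measurable]: "Q \<in> sets borel" "R \<in> sets borel"
    by (auto simp: Q_def R_def upper_slab_def)
  have Q_iff: "z \<in> Q \<longleftrightarrow> \<delta> \<le> z $ i" and R_iff: "z \<in> R \<longleftrightarrow> 1 - \<delta> \<le> z $ i"
    if "z \<in> unit_cube" for z
    using that by (simp_all add: Q_def R_def mem_upper_slab_iff)
  have "Q \<in> upper_corner_boxes" "R \<in> upper_corner_boxes"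
    using \<delta> by (auto simp: Q_def R_def intro!: upper_slab_in_upper_corner_boxes)
  then have nd: "prob {\<omega>\<in>space M. p 1 \<omega> \<in> Q \<and> p 2 \<omega> \<in> R}
      \<le> prob {\<omega>\<in>space M. p 1 \<omega> \<in> Q} * prob {\<omega>\<in>space M. p 2 \<omega> \<in> R}"
    using pnd unfolding pairwise_negatively_dependent_def by blast
  have R_pos: "0 < prob {\<omega>\<in>space M. p 2 \<omega> \<in> R}"
  proof (rule uniform_point_in_set_pos[OF assms(1) point(1,3)[OF idx(2)]])
    show "box (\<chi> k. if k = i then 1 - \<delta> else 0) 1 \<subseteq> R \<inter> unit_cube"
    proof
      fix z :: "real^'d"
      assume "z \<in> box (\<chi> k. if k = i then 1 - \<delta> else 0) 1"
      then have z: "(if k = i then 1 - \<delta> else 0) < z $ k \<and> z $ k < 1" for k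
        by (simp add: mem_box_cart)
      have "0 \<le> z $ k \<and> z $ k < 1" for k
        using z[of k] \<delta> by (cases "k = i") simp_all
      then have "z \<in> unit_cube"
        by (simp add: unit_cube_def half_open_box_def)
      then show "z \<in> R \<inter> unit_cube"
        using z[of i] by (simp add: R_iff)
    qed
    show "box (\<chi> k. if k = i then 1 - \<delta> else 0) (1 :: real^'d) \<noteq> {}"
      using \<delta> by (auto simp: interval_ne_empty_cart)
  qed simp
  have notQ_pos: "0 < prob {\<omega>\<in>space M. p 1 \<omega> \<in> - Q}"
  proof (rule uniform_point_in_set_pos[OF assms(1) point(1,3)[OF idx(1)]])
    show "box 0 (\<chi> k. if k = i then \<delta> else 1) \<subseteq> - Q \<inter> unit_cube"
    proof
      fix z :: "real^'d"
      assume "z \<in> box 0 (\<chi> k. if k = i then \<delta> else 1)"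
      then have z: "0 < z $ k \<and> z $ k < (if k = i then \<delta> else 1)" for k
        by (simp add: mem_box_cart)
      have "0 \<le> z $ k \<and> z $ k < 1" for k
        using z[of k] \<delta> by (cases "k = i") simp_all
      then have "z \<in> unit_cube"
        by (simp add: unit_cube_def half_open_box_def)
      then show "z \<in> - Q \<inter> unit_cube"
        using z[of i] by (simp add: Q_iff)
    qed
    show "box (0 :: real^'d) (\<chi> k. if k = i then \<delta> else 1) \<noteq> {}"
      using \<delta> by (auto simp: interval_ne_empty_cart)
  qed simp
  have "{\<omega>\<in>space M. p 1 \<omega> \<in> Q} \<in> events" by measurable
  then have "prob {\<omega>\<in>space M. p 1 \<omega> \<in> - Q} = 1 - prob {\<omega>\<in>space M. p 1 \<omega> \<in> Q}"
    using prob_neg[of "\<lambda>\<omega>. p 1 \<omega> \<in> Q"] by simp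
  with notQ_pos have Q_less: "prob {\<omega>\<in>space M. p 1 \<omega> \<in> Q} < 1" by simp
  have corner: "torus_dist (p 1 \<omega> $ i) (p 2 \<omega> $ i) \<le> \<epsilon>"
    if "\<omega> \<in> space M" "p 1 \<omega> \<notin> Q" "p 2 \<omega> \<in> R" for \<omega>
  proof -
    have cube: "p 1 \<omega> \<in> unit_cube" "p 2 \<omega> \<in> unit_cube"
      using point(2) idx that(1) by auto
    then have "0 \<le> p 1 \<omega> $ i" "p 2 \<omega> $ i < 1"
      by (auto simp: unit_cube_def half_open_box_def)
    moreover have "p 1 \<omega> $ i < \<delta>" "1 - \<delta> \<le> p 2 \<omega> $ i"
      using that cube by (auto simp: Q_iff R_iff)
    ultimately show ?thesis
      using torus_dist_le_opposite_ends[of "p 1 \<omega> $ i" \<delta> "p 2 \<omega> $ i"] \<delta> by simp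
  qed
  let ?near = "{\<omega>\<in>space M. torus_dist (p 1 \<omega> $ i) (p 2 \<omega> $ i) \<le> \<epsilon>}"
  \<comment> \<open>Without this, \<open>null\<close> says nothing: a non-measurable set also has \<open>measure\<close> zero.\<close>
  have near: "?near \<in> sets M" unfolding torus_dist_def by measurable
  have both: "{\<omega>\<in>space M. p 1 \<omega> \<in> Q \<and> p 2 \<omega> \<in> R} \<in> events" by measurable
  have "prob {\<omega>\<in>space M. p 2 \<omega> \<in> R}
      \<le> prob ({\<omega>\<in>space M. p 1 \<omega> \<in> Q \<and> p 2 \<omega> \<in> R} \<union> ?near)"
    using corner sets.Un[OF both near] by (intro finite_measure_mono) auto
  also have "\<dots> \<le> prob {\<omega>\<in>space M. p 1 \<omega> \<in> Q \<and> p 2 \<omega> \<in> R} + prob ?near"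
    by (rule measure_Un_le[OF both near])
  also have "\<dots> \<le> prob {\<omega>\<in>space M. p 1 \<omega> \<in> Q} * prob {\<omega>\<in>space M. p 2 \<omega> \<in> R}"
    using nd null by simp
  also have "\<dots> < prob {\<omega>\<in>space M. p 2 \<omega> \<in> R}"
    using Q_less R_pos by simp
  finally show False by simp
qed

end
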